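(* Let $X$ be a commutative ring (with unity $1$) with an equivalence relation $\sim$ such that the canonical surjection $X\to X/\!\sim$, $x\mapsto [x]_m$, is a surjective morphism of rings. Let $k\ge 1$, let $f:X^k\to X$ be a linear map, $f(x_1,\ldots,x_k)=\sum_{j=1}^k f_j x_j$ with $f_1,\ldots,f_k\in X$, and let $(a_n)_{n\ge 1}$ be the sequence in $X$ with given initial values $a_1,\ldots,a_k$ and $a_{i+k}=f(a_i,\ldots,a_{i+k-1})$ for all $i\ge 1$. Let $\ell(m)$ be a positive integer with $\ell(m)>k-1$. If for all $i\in\{1,\ldots,k\}$ $$[f_i]_m=[a_i]_m,\qquad [a_{2i+\ell(m)-k-1}]_m=[1]_m,$$ and $$\sum_{j\in\{1,\ldots,k\}\setminus\{i\}}[f_j]_m\cdot[a_{i+\ell(m)-k+j-1}]_m=[0]_m,$$ then $a$ is periodic modulo $m$ with period $\ell(m)$.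
   Context: $[x]_m$ denotes the class of $x\in X$ in $X/\!\sim$; in the basic case $X=\mathbb{Z}$, $m$ is a positive integer, $\sim$ is congruence modulo $m$ and $[x]_m$ is the residue class of $x$ in $\mathbb{Z}/m\mathbb{Z}$. A sequence $(a_n)_{n\ge1}$ is periodic modulo $m$ with period $\ell(m)$ (a positive integer) if $[a_n]_m=[a_{n+\ell(m)}]_m$ for all $n\ge 1$. *)

theory Defs
  imports "HOL-Algebra.RingHom"
begin

abbreviation residue_class :: "('a \<times> 'a) set \<Rightarrow> 'a \<Rightarrow> 'a set" where
  "residue_class E x \<equiv> E `` {x}"

text \<open>A ring structure \<open>Q\<close> on the set of equivalence classes for which the canonical map is a
  morphism of rings; it is surjective because the carrier of \<open>Q\<close> is the whole quotient set.
  Such a \<open>Q\<close> is determined by \<open>R\<close> and \<open>E\<close>: membership in \<^const>\<open>ring_hom\<close> fixes its operations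
  and its unit on classes.\<close>

definition is_quotient_ring ::
    "('a, 'b) ring_scheme \<Rightarrow> ('a \<times> 'a) set \<Rightarrow> ('a set, 'c) ring_scheme \<Rightarrow> bool" where
  "is_quotient_ring R E Q \<longleftrightarrow>
     equiv (carrier R) E \<and> ring Q \<and> carrier Q = carrier R // E \<and> residue_class E \<in> ring_hom R Q"

text \<open>Tuples \<open>(x\<^sub>1, \<dots>, x\<^sub>k)\<close> are functions on \<^typ>\<open>nat\<close>, of which only the values on
  \<open>{1..k}\<close> matter.\<close>

definition linear_map_of ::
    "('a, 'b) ring_scheme \<Rightarrow> nat \<Rightarrow> (nat \<Rightarrow> 'a) \<Rightarrow> (nat \<Rightarrow> 'a) \<Rightarrow> 'a" where
  "linear_map_of R k f x = (\<Oplus>\<^bsub>R\<^esub>j\<in>{1..k}. f j \<otimes>\<^bsub>R\<^esub> x j)"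

text \<open>Sequences start at index 1; the value at 0 is irrelevant.\<close>

definition periodic_mod :: "('a \<times> 'a) set \<Rightarrow> (nat \<Rightarrow> 'a) \<Rightarrow> nat \<Rightarrow> bool" where
  "periodic_mod E a l \<longleftrightarrow> l > 0 \<and> (\<forall>n\<ge>1. residue_class E (a n) = residue_class E (a (n + l)))"

end

theory Submission
  imports Defs "HOL-Algebra.UnivPoly"
begin

text \<open>The canonical map carries the recurrence over to the quotient. Each class \<open>[a\<^bsub>i+l\<^esub>]\<close> with
  \<open>1 \<le> i \<le> k\<close> lies past the initial values because \<open>l \<ge> k\<close>, so it is a sum of \<open>k\<close> products, of
  which the \<open>i\<close>-th is \<open>[f\<^sub>i] [a\<^bsub>2i+l-k-1\<^esub>] = [f\<^sub>i] = [a\<^sub>i]\<close> while the others add up to zero.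
  So the sequence shifted by \<open>l\<close> agrees with the original one on the first \<open>k\<close> classes. The
  classes satisfy a recurrence of order \<open>k\<close>, which both sequences share, hence they agree
  everywhere.\<close>

lemma linear_recurrence_closed:
  assumes "ring R"
    and f: "\<And>j. j \<in> {1..k} \<Longrightarrow> f j \<in> carrier R"
    and init: "\<And>i. i \<in> {1..k} \<Longrightarrow> a i \<in> carrier R"
    and rec: "\<And>i. i \<ge> 1 \<Longrightarrow> a (i + k) = linear_map_of R k f (\<lambda>j. a (i + j - 1))"
    and "n \<ge> 1"
  shows "a n \<in> carrier R"
  using \<open>n \<ge> 1\<close>
proof (induction n rule: less_induct)
  case (less n)
  interpret ring R by fact
  show ?case
  proof (cases "n \<le> k")
    case True
    then show ?thesis using init less.prems by simp
  next
    case False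
    have "a (n - k + k) = linear_map_of R k f (\<lambda>j. a (n - k + j - 1))"
      using False by (intro rec) simp
    moreover have "a (n - k + j - 1) \<in> carrier R" if "j \<in> {1..k}" for j
      using that False by (intro less.IH) auto
    ultimately show ?thesis
      using False f by (auto simp: linear_map_of_def intro!: finsum_closed)
  qed
qed

lemma linear_recurrence_unique:
  fixes u v :: "nat \<Rightarrow> 'a"
  assumes init: "\<And>i. i \<in> {1..k} \<Longrightarrow> u i = v i"
    and u: "\<And>i. i \<ge> 1 \<Longrightarrow> u (i + k) = linear_map_of Q k g (\<lambda>j. u (i + j - 1))"
    and v: "\<And>i. i \<ge> 1 \<Longrightarrow> v (i + k) = linear_map_of Q k g (\<lambda>j. v (i + j - 1))"
    and closed: "ring Q" "\<And>j. j \<in> {1..k} \<Longrightarrow> g j \<in> carrier Q"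
      "\<And>i. i \<ge> 1 \<Longrightarrow> v i \<in> carrier Q"
    and "n \<ge> 1"
  shows "u n = v n"
  using \<open>n \<ge> 1\<close>
proof (induction n rule: less_induct)
  case (less n)
  interpret ring Q by fact
  show ?case
  proof (cases "n \<le> k")
    case True
    then show ?thesis using init less.prems by simp
  next
    case False
    have "u (n - k + k) = linear_map_of Q k g (\<lambda>j. u (n - k + j - 1))"
      using False by (intro u) simp
    also have "\<dots> = linear_map_of Q k g (\<lambda>j. v (n - k + j - 1))"
      unfolding linear_map_of_def
    proof (rule add.finprod_cong')
      show "(\<lambda>j. g j \<otimes>\<^bsub>Q\<^esub> v (n - k + j - 1)) \<in> {1..k} \<rightarrow> carrier Q"
        using False closed by auto
      show "g j \<otimes>\<^bsub>Q\<^esub> u (n - k + j - 1) = g j \<otimes>\<^bsub>Q\<^esub> v (n - k + j - 1)" if "j \<in> {1..k}" for j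
        using that False less.IH[of "n - k + j - 1"] by auto
    qed simp
    also have "\<dots> = v (n - k + k)"
      using False by (intro v[symmetric]) simp
    finally show ?thesis using False by simp
  qed
qed

lemma hom_linear_map_of:
  assumes "ring R" "ring Q" "h \<in> ring_hom R Q"
    and f: "\<And>j. j \<in> {1..k} \<Longrightarrow> f j \<in> carrier R"
    and x: "\<And>j. j \<in> {1..k} \<Longrightarrow> x j \<in> carrier R"
  shows "h (linear_map_of R k f x) = linear_map_of Q k (\<lambda>j. h (f j)) (\<lambda>j. h (x j))"
proof -
  interpret ring_hom_ring R Q h
    using assms by (intro ring_hom_ringI2)
  have "h (linear_map_of R k f x) = (\<Oplus>\<^bsub>Q\<^esub>j\<in>{1..k}. (h \<circ> (\<lambda>j. f j \<otimes>\<^bsub>R\<^esub> x j)) j)"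
    unfolding linear_map_of_def using f x by (subst hom_finsum) (auto simp: comp_def)
  also have "\<dots> = linear_map_of Q k (\<lambda>j. h (f j)) (\<lambda>j. h (x j))"
    unfolding linear_map_of_def using f x by (intro S.add.finprod_cong') auto
  finally show ?thesis .
qed

text \<open>Applied to the window of the sequence that determines \<open>[a\<^bsub>i+l\<^esub>]\<close>, this is where the
  conditions on \<open>l\<close> make an initial class return, by way of the coefficient \<open>[f\<^sub>i] = [a\<^sub>i]\<close>.\<close>

lemma linear_map_of_eq_coefficient:
  assumes "ring Q" and i: "i \<in> {1..k}"
    and g: "\<And>j. j \<in> {1..k} \<Longrightarrow> g j \<in> carrier Q"
    and y: "\<And>j. j \<in> {1..k} \<Longrightarrow> y j \<in> carrier Q"
    and one: "y i = \<one>\<^bsub>Q\<^esub>"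
    and rest: "(\<Oplus>\<^bsub>Q\<^esub>j\<in>{1..k} - {i}. g j \<otimes>\<^bsub>Q\<^esub> y j) = \<zero>\<^bsub>Q\<^esub>"
  shows "linear_map_of Q k g y = g i"
proof -
  interpret ring Q by fact
  have "linear_map_of Q k g y = (\<Oplus>\<^bsub>Q\<^esub>j\<in>insert i ({1..k} - {i}). g j \<otimes>\<^bsub>Q\<^esub> y j)"
    using i by (simp add: linear_map_of_def insert_absorb)
  also have "\<dots> = g i \<otimes>\<^bsub>Q\<^esub> y i \<oplus>\<^bsub>Q\<^esub> (\<Oplus>\<^bsub>Q\<^esub>j\<in>{1..k} - {i}. g j \<otimes>\<^bsub>Q\<^esub> y j)"
    using i g y by (intro finsum_insert) auto
  finally show ?thesis using g[OF i] one rest by simp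
qed

theorem theorem2p7:
  fixes R :: "('a, 'b) ring_scheme" and E :: "('a \<times> 'a) set" and Q :: "('a set, 'c) ring_scheme"
    and k l :: nat and f a :: "nat \<Rightarrow> 'a"
  assumes "cring R"
    and "is_quotient_ring R E Q"
    and "k \<ge> 1"
    and "\<And>j. j \<in> {1..k} \<Longrightarrow> f j \<in> carrier R"
    and "\<And>i. i \<in> {1..k} \<Longrightarrow> a i \<in> carrier R"
    and "\<And>i. i \<ge> 1 \<Longrightarrow> a (i + k) = linear_map_of R k f (\<lambda>j. a (i + j - 1))"
    and "l > 0"
    and "l > k - 1"
    and "\<And>i. i \<in> {1..k} \<Longrightarrow> residue_class E (f i) = residue_class E (a i)"
    and "\<And>i. i \<in> {1..k} \<Longrightarrow> residue_class E (a (2 * i + l - k - 1)) = residue_class E \<one>\<^bsub>R\<^esub>"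
    and "\<And>i. i \<in> {1..k} \<Longrightarrow>
           (\<Oplus>\<^bsub>Q\<^esub>j\<in>{1..k} - {i}.
              residue_class E (f j) \<otimes>\<^bsub>Q\<^esub> residue_class E (a (i + l - k + j - 1)))
           = residue_class E \<zero>\<^bsub>R\<^esub>"
  shows "periodic_mod E a l"
proof -
  define c where "c = residue_class E"
  define g where "g = (\<lambda>j. c (f j))"
  define b where "b = (\<lambda>n. c (a n))"
  have ring: "ring R" "ring Q" and hom: "c \<in> ring_hom R Q"
    using assms(1,2) by (auto simp: is_quotient_ring_def c_def cring_def)
  interpret ring_hom_ring R Q c
    using ring hom by (rule ring_hom_ringI2)
  have a_closed: "a n \<in> carrier R" if "n \<ge> 1" for n
    using linear_recurrence_closed[OF ring(1) assms(4-6) that] .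
  have g_closed: "g j \<in> carrier Q" if "j \<in> {1..k}" for j
    using assms(4) that by (simp add: g_def)
  have b_closed: "b n \<in> carrier Q" if "n \<ge> 1" for n
    using a_closed that by (simp add: b_def)
  have b_rec: "b (i + k) = linear_map_of Q k g (\<lambda>j. b (i + j - 1))" if "i \<ge> 1" for i
    unfolding b_def g_def assms(6)[OF that]
    using that by (intro hom_linear_map_of ring hom assms(4) a_closed) auto
  have shifted_init: "b (i + l) = b i" if i: "i \<in> {1..k}" for i
  proof -
    have eq: "i + l = (i + l - k) + k" and pos: "i + l - k \<ge> 1"
      using i assms(8) by auto
    have "b (i + l) = linear_map_of Q k g (\<lambda>j. b (i + l - k + j - 1))"
      using b_rec[OF pos] eq by simp
    also have "\<dots> = g i"
    proof (rule linear_map_of_eq_coefficient[OF ring(2) i g_closed])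
      show "b (i + l - k + j - 1) \<in> carrier Q" if "j \<in> {1..k}" for j
        using that pos by (intro b_closed) auto
      have "i + l - k + i - 1 = 2 * i + l - k - 1"
        using i pos by auto
      then show "b (i + l - k + i - 1) = \<one>\<^bsub>Q\<^esub>"
        using assms(10)[OF i] hom_one by (simp add: b_def c_def)
      show "(\<Oplus>\<^bsub>Q\<^esub>j\<in>{1..k} - {i}. g j \<otimes>\<^bsub>Q\<^esub> b (i + l - k + j - 1)) = \<zero>\<^bsub>Q\<^esub>"
        using assms(11)[OF i] hom_zero by (simp add: b_def g_def c_def)
    qed
    also have "g i = b i"
      using assms(9)[OF i] by (simp add: b_def g_def c_def)
    finally show ?thesis .
  qed
  have shifted_rec: "b (i + k + l) = linear_map_of Q k g (\<lambda>j. b (i + j - 1 + l))" if "i \<ge> 1" for i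
  proof -
    have "(\<lambda>j. b (i + l + j - 1)) = (\<lambda>j. b (i + j - 1 + l))"
      using that by (simp add: add_ac)
    then show ?thesis using b_rec[of "i + l"] that by (simp add: add_ac)
  qed
  have "b (n + l) = b n" if "n \<ge> 1" for n
    using linear_recurrence_unique[where u = "\<lambda>n. b (n + l)" and v = b,
        OF shifted_init shifted_rec b_rec ring(2) g_closed b_closed that] .
  then show ?thesis
    using assms(7) by (simp add: periodic_mod_def b_def c_def)
qed

end
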